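(* Let $d\mu=\mu(x)\,dx$ be a positive measure on $\mathbb{R}^N$ with density $\mu\in L^1_{loc}(\mathbb{R}^N)$, and assume that $N_0:=\sup\{\delta\in\mathbb{R}:|x|^{-\delta}\in L^1_{loc}(\mathbb{R}^N,d\mu)\}$ exists (as a real number). Let $c>c_0(N_0):=\left(\frac{N_0-2}{2}\right)^2$. Then for every constant $C$ there exists a function $\varphi\in H^1_\mu$ for which the weighted Hardy inequality $$c\int_{\mathbb{R}^N}\frac{\varphi^2}{|x|^2}\,d\mu\le\int_{\mathbb{R}^N}|\nabla\varphi|^2\,d\mu+C\int_{\mathbb{R}^N}\varphi^2\,d\mu$$ does not hold.
   Context: $L^2_\mu:=L^2(\mathbb{R}^N,d\mu)$, and $H^1_\mu$ is the Sobolev space of functions in $L^2_\mu$ whose weak first derivatives belong to $L^2_\mu$. Functions are real-valued. *)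

theory Defs
  imports "HOL-Analysis.Analysis"
begin

definition locally_integrable :: "(real^'n) measure \<Rightarrow> (real^'n \<Rightarrow> real) \<Rightarrow> bool" where
  "locally_integrable M f \<longleftrightarrow> (\<forall>K. compact K \<longrightarrow> set_integrable M K f)"

definition weighted_measure :: "(real^'n \<Rightarrow> real) \<Rightarrow> (real^'n) measure" where
  "weighted_measure \<mu> = density lebesgue (\<lambda>x. ennreal (\<mu> x))"

text \<open>The value of \<open>norm x powr - \<delta>\<close> at the origin (which is \<open>0\<close> in HOL) is irrelevant,
  because \<open>{0}\<close> is a null set of \<open>weighted_measure \<mu>\<close>.\<close>

definition integrability_exponents :: "(real^'n \<Rightarrow> real) \<Rightarrow> real set" where
  "integrability_exponents \<mu> =
     {\<delta>. locally_integrable (weighted_measure \<mu>) (\<lambda>x. norm x powr (- \<delta>))}"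

definition L2_weighted :: "(real^'n \<Rightarrow> real) \<Rightarrow> (real^'n \<Rightarrow> real) set" where
  "L2_weighted \<mu> =
     {f. f \<in> borel_measurable (weighted_measure \<mu>) \<and>
         integrable (weighted_measure \<mu>) (\<lambda>x. (f x)\<^sup>2)}"

definition partial_deriv :: "'n \<Rightarrow> (real^'n \<Rightarrow> real) \<Rightarrow> real^'n \<Rightarrow> real" where
  "partial_deriv i f x = frechet_derivative f (at x) (axis i 1)"

primrec continuously_differentiable :: "nat \<Rightarrow> (real^'n \<Rightarrow> real) \<Rightarrow> bool" where
  "continuously_differentiable 0 f \<longleftrightarrow> continuous_on UNIV f"
| "continuously_differentiable (Suc k) f \<longleftrightarrow>
     (\<forall>x. f differentiable (at x)) \<and> (\<forall>i. continuously_differentiable k (partial_deriv i f))"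

definition test_functions :: "(real^'n \<Rightarrow> real) set" where
  "test_functions =
     {\<psi>. (\<forall>k. continuously_differentiable k \<psi>) \<and> compact (closure {x. \<psi> x \<noteq> 0})}"

text \<open>The weak gradient is taken with respect to Lebesgue measure, not the weighted measure;
  hence local Lebesgue integrability is required explicitly, as it does not follow from
  membership in the weighted \<open>L\<^sup>2\<close> space when \<open>\<mu>\<close> degenerates.
  A weak gradient is determined up to Lebesgue null sets.\<close>

definition has_weak_gradient :: "(real^'n \<Rightarrow> real) \<Rightarrow> (real^'n \<Rightarrow> real^'n) \<Rightarrow> bool" where
  "has_weak_gradient \<phi> g \<longleftrightarrow>
     locally_integrable lebesgue \<phi> \<and>
     (\<forall>i. locally_integrable lebesgue (\<lambda>x. g x $ i)) \<and>
     (\<forall>\<psi>\<in>test_functions. \<forall>i.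
        (\<integral>x. \<phi> x * partial_deriv i \<psi> x \<partial>lebesgue) = - (\<integral>x. g x $ i * \<psi> x \<partial>lebesgue))"

definition H1_weighted :: "(real^'n \<Rightarrow> real) \<Rightarrow> (real^'n \<Rightarrow> real) set" where
  "H1_weighted \<mu> =
     {\<phi>. \<phi> \<in> L2_weighted \<mu> \<and>
         (\<exists>g. has_weak_gradient \<phi> g \<and> (\<forall>i. (\<lambda>x. g x $ i) \<in> L2_weighted \<mu>))}"

text \<open>The integrals are taken in \<open>[0, \<infinity>]\<close>, so that the inequality fails when the left-hand
  integral diverges while the right-hand side is finite; it is stated in \<open>ereal\<close> because the
  constant \<open>C\<close> may be negative.  The argument \<open>g\<close> stands for a weak gradient of \<open>\<phi>\<close>.\<close>

definition weighted_Hardy_inequality ::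
  "(real^'n \<Rightarrow> real) \<Rightarrow> real \<Rightarrow> real \<Rightarrow> (real^'n \<Rightarrow> real) \<Rightarrow> (real^'n \<Rightarrow> real^'n) \<Rightarrow> bool" where
  "weighted_Hardy_inequality \<mu> c C \<phi> g \<longleftrightarrow>
     ereal c * enn2ereal (\<integral>\<^sup>+x. ennreal ((\<phi> x)\<^sup>2 / (norm x)\<^sup>2) \<partial>weighted_measure \<mu>)
     \<le> enn2ereal (\<integral>\<^sup>+x. ennreal ((norm (g x))\<^sup>2) \<partial>weighted_measure \<mu>)
       + ereal C * enn2ereal (\<integral>\<^sup>+x. ennreal ((\<phi> x)\<^sup>2) \<partial>weighted_measure \<mu>)"

end

theory Submission
  imports Defs
begin

text \<open>Choose \<open>\<gamma>\<close> slightly below \<open>1 - N0 / 2\<close>, so that \<open>\<gamma>\<^sup>2 < c\<close> and \<open>- 2 \<gamma> < N0 < 2 - 2 \<gamma>\<close>, and test the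
  inequality with \<open>(|x|\<^sup>2 + \<epsilon>)\<close> to the power \<open>\<gamma> / 2\<close>, cut off outside the unit ball.  Unlike a truncation of
  \<open>|x|\<close> to the power \<open>\<gamma>\<close>, this is \<open>C\<^sup>1\<close>, so its weak gradient is the classical one.  With
  \<open>I(\<epsilon>)\<close> the integral of \<open>(|x|\<^sup>2 + \<epsilon>)\<close> to the power \<open>\<gamma> - 1\<close> over the unit ball, the left-hand side is at
  least \<open>c I(\<epsilon>)\<close>, while the Dirichlet integral is at most \<open>\<gamma>\<^sup>2 I(\<epsilon>) + O(1)\<close> and the \<open>L\<^sup>2\<close> norm
  stays bounded.  Hence the inequality would bound \<open>I(\<epsilon>)\<close>, but \<open>I(\<epsilon>) \<rightarrow> \<infinity>\<close> as \<open>\<epsilon> \<rightarrow> 0\<close>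
  because \<open>2 - 2 \<gamma> > N0\<close>.\<close>

section \<open>Integration and weak gradients of compactly supported functions\<close>

text \<open>The measure is left arbitrary because \<open>lborel\<close>, \<open>lebesgue\<close> and
  the weighted measure all occur; continuity supplies a bound on the ball.\<close>

lemma integrable_continuous_compact_support:
  fixes f :: "'a::euclidean_space \<Rightarrow> real"
  assumes "f \<in> borel_measurable M" "cball 0 R \<in> sets M" "emeasure M (cball 0 R) < \<infinity>"
    and cont: "continuous_on UNIV f" and supp: "\<And>x. norm x > R \<Longrightarrow> f x = 0"
  shows "integrable M f"
proof -
  have "bounded (f ` cball 0 R)"
    by (intro compact_imp_bounded compact_continuous_image continuous_on_subset[OF cont]) auto
  then obtain B where B: "\<And>x. x \<in> cball 0 R \<Longrightarrow> norm (f x) \<le> B"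
    unfolding bounded_iff by fastforce
  show ?thesis
    by (rule integrableI_bounded_set[where A = "cball 0 R" and B = B]) (use assms B in auto)
qed

lemma borel_measurable_lebesgue_continuous:
  fixes f :: "'a::euclidean_space \<Rightarrow> 'b::topological_space"
  shows "continuous_on UNIV f \<Longrightarrow> f \<in> borel_measurable lebesgue"
  by (intro measurable_completion) (simp add: borel_measurable_continuous_onI)

lemma locally_integrable_lebesgue_continuous:
  fixes f :: "real^'n \<Rightarrow> real"
  assumes "continuous_on UNIV f"
  shows "locally_integrable lebesgue f"
  unfolding locally_integrable_def
proof (intro allI impI)
  fix K :: "(real^'n) set" assume K: "compact K"
  have "set_integrable lborel K f"
    using borel_integrable_compact[OF K continuous_on_subset[OF assms]]
    by (auto simp: set_integrable_def indicator_def if_distrib cong: if_cong)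
  thus "set_integrable lebesgue K f"
    unfolding set_integrable_def
    using integrable_completion by (metis borel_measurable_integrable)
qed

text \<open>The integral of a difference quotient vanishes by translation invariance, which avoids Fubini.\<close>

lemma integral_directional_derivative_zero:
  fixes u :: "'a::euclidean_space \<Rightarrow> real"
  assumes der: "\<And>x. (u has_derivative D x) (at x)"
    and cont: "continuous_on UNIV (\<lambda>x. D x e)"
    and supp: "\<And>x. norm x > R \<Longrightarrow> u x = 0"
  shows "(\<integral>x. D x e \<partial>lebesgue) = 0"
proof -
  define t where "t n = inverse (real (Suc n))" for n
  have t: "0 < t n" "t n \<le> 1" for n by (auto simp: t_def field_simps)
  have t0: "t \<longlonglongrightarrow> 0" unfolding t_def by (rule LIMSEQ_inverse_real_of_nat)
  \<comment> \<open>Since \<open>t n \<le> 1\<close>, a translation moves points by at most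
    \<open>norm e\<close>. So the difference quotients vanish outside \<open>K\<close>, and segments
    starting in \<open>K\<close> stay in \<open>S\<close>, where the derivative is bounded.\<close>
  define S where "S = cball (0::'a) (R + 2 * norm e)"
  define K where "K = cball (0::'a) (R + norm e)"
  have ucont: "continuous_on UNIV u"
    using der by (meson continuous_at_imp_continuous_on has_derivative_continuous)
  have um[measurable]: "u \<in> borel_measurable borel" using ucont by (rule borel_measurable_continuous_onI)
  have dm[measurable]: "(\<lambda>x. D x e) \<in> borel_measurable borel" using cont by (rule borel_measurable_continuous_onI)
  have "bounded ((\<lambda>x. D x e) ` S)"
    unfolding S_def
    by (intro compact_imp_bounded compact_continuous_image continuous_on_subset[OF cont]) auto
  then obtain B where B: "\<And>x. x \<in> S \<Longrightarrow> \<bar>D x e\<bar> \<le> B"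
    unfolding bounded_iff by fastforce
  have line_der: "((\<lambda>s. u (x + s *\<^sub>R e)) has_real_derivative D (x + s *\<^sub>R e) e) (at s)" for x s
  proof -
    have "((\<lambda>s. x + s *\<^sub>R e) has_derivative (\<lambda>h. h *\<^sub>R e)) (at s)"
      by (auto intro!: derivative_eq_intros)
    from has_derivative_compose[OF this der] show ?thesis
      using linear_cmul[OF has_derivative_linear[OF der]]
      by (simp add: has_field_derivative_def mult_commute_abs)
  qed
  define q where "q n x = (u (x + t n *\<^sub>R e) - u x) / t n" for n x
  have qlim: "(\<lambda>n. q n x) \<longlonglongrightarrow> D x e" for x
  proof -
    have "((\<lambda>h. (u (x + h *\<^sub>R e) - u x) / h) \<longlongrightarrow> D x e) (at 0)"
      using line_der[of x 0] by (simp add: has_field_derivative_iff)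
    moreover have "filterlim t (at 0) sequentially"
      using t0 t(1) by (auto simp: filterlim_at intro!: always_eventually less_imp_neq[symmetric])
    ultimately show ?thesis unfolding q_def by (rule filterlim_compose)
  qed
  have qbound: "norm (q n x) \<le> B * indicator K x" for n x
  proof (cases "x \<in> K")
    case False
    have "norm (x + t n *\<^sub>R e) \<ge> norm x - norm (t n *\<^sub>R e)" by (rule norm_diff_ineq)
    moreover have "norm (t n *\<^sub>R e) \<le> norm e" using t[of n] by (simp add: mult_left_le_one_le)
    ultimately have "norm (x + t n *\<^sub>R e) > R" using False by (auto simp: K_def)
    moreover have "norm x > R" using False norm_ge_zero[of e] unfolding K_def mem_cball_0 by linarith
    ultimately show ?thesis using False by (simp add: q_def supp)
  next
    case True
    \<comment> \<open>The mean value theorem turns the quotient into a derivative at a point of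
      \<open>S\<close>, so one bound serves all \<open>n\<close>.\<close>
    obtain z where z: "0 < z" "z < t n"
      "u (x + t n *\<^sub>R e) - u (x + 0 *\<^sub>R e) = (t n - 0) * D (x + z *\<^sub>R e) e"
      using MVT2[OF t(1)[of n], of "\<lambda>s. u (x + s *\<^sub>R e)" "\<lambda>s. D (x + s *\<^sub>R e) e"] line_der by blast
    have "norm (x + z *\<^sub>R e) \<le> norm x + norm (z *\<^sub>R e)" by (rule norm_triangle_ineq)
    also have "norm (z *\<^sub>R e) \<le> norm e" using z t[of n] by (simp add: mult_left_le_one_le)
    finally have "x + z *\<^sub>R e \<in> S" using True by (auto simp: K_def S_def)
    with B z t(1)[of n] True show ?thesis by (simp add: q_def)
  qed
  have uint: "integrable lborel u"
    by (rule integrable_continuous_compact_support[where R = R])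
      (use ucont supp emeasure_lborel_cball_finite[of 0 R] in auto)
  have "(\<integral>x. q n x \<partial>lborel) = 0" for n
  proof -
    have i: "integrable lborel (\<lambda>x. u (t n *\<^sub>R e + x))"
      using lborel_integrable_real_affine uint
      by (subst (asm) lborel_distr_plus[symmetric, of "t n *\<^sub>R e"]) (simp add: integrable_distr_eq)
    have e: "(\<integral>x. u (t n *\<^sub>R e + x) \<partial>lborel) = (\<integral>x. u x \<partial>lborel)"
      by (subst (2) lborel_distr_plus[symmetric, of "t n *\<^sub>R e"]) (simp add: integral_distr)
    have "(\<integral>x. q n x \<partial>lborel) = (\<integral>x. (u (t n *\<^sub>R e + x) - u x) / t n \<partial>lborel)"
      by (simp add: q_def add.commute)
    also have "\<dots> = 0" using i e uint by simp
    finally show ?thesis .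
  qed
  moreover have "(\<lambda>n. \<integral>x. q n x \<partial>lborel) \<longlonglongrightarrow> (\<integral>x. D x e \<partial>lborel)"
  proof (rule integral_dominated_convergence)
    show "integrable lborel (\<lambda>x. B * indicator K x)"
      unfolding K_def using emeasure_lborel_cball_finite[of 0 "R + norm e"]
      by (intro integrable_mult_right integrable_real_indicator) auto
    show "q n \<in> borel_measurable lborel" for n unfolding q_def by measurable
  qed (use qlim qbound in auto)
  ultimately have "(\<integral>x. D x e \<partial>lborel) = 0"
    by (simp add: LIMSEQ_const_iff)
  thus ?thesis by (subst integral_completion) auto
qed

text \<open>Integration by parts: the product rule splits the derivative of
  \<open>\<phi> x * \<psi> x\<close> along \<open>axis i 1\<close> into the two integrands, and its
  total integral vanishes because the product has bounded support.\<close>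

lemma has_weak_gradient_continuously_differentiable:
  fixes \<phi> :: "real^'n \<Rightarrow> real"
  assumes der: "\<And>x. (\<phi> has_derivative (\<lambda>h. g x \<bullet> h)) (at x)"
    and cont: "continuous_on UNIV g" and supp: "\<And>x. norm x > R \<Longrightarrow> \<phi> x = 0"
  shows "has_weak_gradient \<phi> g"
  unfolding has_weak_gradient_def
proof (intro conjI allI ballI)
  have \<phi>c: "continuous_on UNIV \<phi>"
    using der by (meson continuous_at_imp_continuous_on has_derivative_continuous)
  have gc: "continuous_on UNIV (\<lambda>x. g x $ i)" for i using cont by (intro continuous_intros)
  show "locally_integrable lebesgue \<phi>" "locally_integrable lebesgue (\<lambda>x. g x $ i)" for i
    by (intro locally_integrable_lebesgue_continuous \<phi>c gc)+
  fix \<psi> :: "real^'n \<Rightarrow> real" and i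
  assume "\<psi> \<in> test_functions"
  hence C1: "continuously_differentiable (Suc 0) \<psi>" and "compact (closure {x. \<psi> x \<noteq> 0})"
    by (auto simp: test_functions_def simp del: continuously_differentiable.simps)
  hence "bounded (closure {x. \<psi> x \<noteq> 0})" by (simp add: compact_imp_bounded)
  then obtain R' where R': "\<And>x. norm x > R' \<Longrightarrow> \<psi> x = 0"
    by (metis (mono_tags, lifting) bounded_iff closure_subset linorder_not_le mem_Collect_eq subsetD)
  have \<psi>d: "(\<psi> has_derivative frechet_derivative \<psi> (at x)) (at x)" for x
    using C1 by (simp add: frechet_derivative_works)
  have pc: "continuous_on UNIV (partial_deriv i \<psi>)" using C1 by simp
  have \<psi>c: "continuous_on UNIV \<psi>"
    using \<psi>d by (meson continuous_at_imp_continuous_on has_derivative_continuous)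
  let ?D = "\<lambda>x h. \<phi> x * frechet_derivative \<psi> (at x) h + (g x \<bullet> h) * \<psi> x"
  have e: "?D x (axis i 1) = \<phi> x * partial_deriv i \<psi> x + g x $ i * \<psi> x" for x
    by (simp add: partial_deriv_def inner_axis)
  have "(\<integral>x. ?D x (axis i 1) \<partial>lebesgue) = 0"
  proof (rule integral_directional_derivative_zero)
    show "((\<lambda>x. \<phi> x * \<psi> x) has_derivative ?D x) (at x)" for x
      by (rule has_derivative_mult[OF der \<psi>d])
    show "continuous_on UNIV (\<lambda>x. ?D x (axis i 1))"
      unfolding e by (intro continuous_intros \<phi>c pc gc \<psi>c)
  qed (use supp in auto)
  moreover have "integrable lebesgue (\<lambda>x. \<phi> x * partial_deriv i \<psi> x)"
    by (rule integrable_continuous_compact_support[where R = R])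
      (use supp in \<open>auto intro!: continuous_intros borel_measurable_lebesgue_continuous \<phi>c pc simp: emeasure_lborel_cball_finite[unfolded infinity_ennreal_def]\<close>)
  \<comment> \<open>Here the bounded support comes from \<open>\<psi>\<close>, since only
    \<open>\<phi>\<close> is assumed to vanish outside the ball of radius \<open>R\<close>.\<close>
  moreover have "integrable lebesgue (\<lambda>x. g x $ i * \<psi> x)"
    by (rule integrable_continuous_compact_support[where R = R'])
      (use R' in \<open>auto intro!: continuous_intros borel_measurable_lebesgue_continuous \<psi>c gc simp: emeasure_lborel_cball_finite[unfolded infinity_ennreal_def]\<close>)
  ultimately have "(\<integral>x. \<phi> x * partial_deriv i \<psi> x \<partial>lebesgue) + (\<integral>x. g x $ i * \<psi> x \<partial>lebesgue) = 0"
    unfolding e by (subst Bochner_Integration.integral_add[symmetric])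
  thus "(\<integral>x. \<phi> x * partial_deriv i \<psi> x \<partial>lebesgue) = - (\<integral>x. g x $ i * \<psi> x \<partial>lebesgue)"
    by (rule eq_neg_iff_add_eq_0[THEN iffD2])
qed

section \<open>A continuously differentiable cutoff\<close>

text \<open>Squaring removes the kink of the positive part: at the origin the difference quotient is
  at most \<open>\<bar>h\<bar>\<close>.\<close>

lemma DERIV_positive_part_squared:
  "((\<lambda>x::real. (max 0 x)\<^sup>2) has_real_derivative 2 * max 0 x) (at x)"
proof -
  consider "x > 0" | "x < 0" | "x = 0" by linarith
  thus ?thesis
  proof cases
    case 1
    show ?thesis
      by (rule has_field_derivative_transform_within_open[where S = "{0<..}" and f = "\<lambda>x. x\<^sup>2"])
        (use 1 in \<open>auto intro!: derivative_eq_intros\<close>)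
  next
    case 2
    show ?thesis
      by (rule has_field_derivative_transform_within_open[where S = "{..<0}" and f = "\<lambda>x. 0"])
        (use 2 in \<open>auto intro!: derivative_eq_intros\<close>)
  next
    case 3
    have "((\<lambda>h::real. (max 0 h)\<^sup>2 / h) \<longlongrightarrow> 0) (at 0)"
    proof (rule Lim_null_comparison)
      show "\<forall>\<^sub>F h::real in at 0. norm ((max 0 h)\<^sup>2 / h) \<le> \<bar>h\<bar>"
        by (intro always_eventually) (auto simp: max_def power2_eq_square)
      show "((\<lambda>h::real. \<bar>h\<bar>) \<longlongrightarrow> 0) (at 0)" by (auto intro!: tendsto_eq_intros)
    qed
    with 3 show ?thesis by (simp add: has_field_derivative_iff)
  qed
qed

text \<open>The argument stands for the squared norm. Nesting two squared positive parts gives a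
  piecewise polynomial C1 transition from 1 on \<open>s \<le> 1\<close> to 0 on
  \<open>s \<ge> 2\<close>.\<close>

definition cutoff :: "real \<Rightarrow> real" where
  "cutoff s = (max 0 (1 - (max 0 (s - 1))\<^sup>2))\<^sup>2"

definition cutoff_deriv :: "real \<Rightarrow> real" where
  "cutoff_deriv s = - 4 * max 0 (1 - (max 0 (s - 1))\<^sup>2) * max 0 (s - 1)"

lemma DERIV_cutoff: "(cutoff has_real_derivative cutoff_deriv s) (at s)"
proof -
  have 1: "((\<lambda>s. (max 0 (s - 1))\<^sup>2) has_real_derivative 2 * max 0 (s - 1)) (at s)"
    using DERIV_positive_part_squared[of "s + - 1"] by (subst (asm) DERIV_shift) simp
  have 2: "((\<lambda>s. 1 - (max 0 (s - 1))\<^sup>2) has_real_derivative - (2 * max 0 (s - 1))) (at s)"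
    using DERIV_diff[OF DERIV_const 1] by simp
  show ?thesis
    using DERIV_chain'[OF 2 DERIV_positive_part_squared]
    by (simp add: cutoff_def[abs_def] cutoff_deriv_def mult_ac)
qed

lemma cutoff_eq_1: "s \<le> 1 \<Longrightarrow> cutoff s = 1" and cutoff_deriv_eq_0: "s \<le> 1 \<Longrightarrow> cutoff_deriv s = 0"
  by (auto simp: cutoff_def cutoff_deriv_def)

lemma cutoff_outside:
  assumes "s \<ge> 2" shows "cutoff s = 0" "cutoff_deriv s = 0"
proof -
  have "(max 0 (s - 1))\<^sup>2 \<ge> 1" using assms by (intro one_le_power) auto
  thus "cutoff s = 0" "cutoff_deriv s = 0" by (auto simp: cutoff_def cutoff_deriv_def)
qed

lemma cutoff_bounds: "0 \<le> cutoff s" "cutoff s \<le> 1"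
  by (auto simp: cutoff_def intro!: power_le_one)

text \<open>The factor \<open>max 0 (s - 1)\<close> is unbounded, but from 2 on the other factor
  vanishes; below 2 both lie between 0 and 1, leaving the coefficient 4.\<close>

lemma cutoff_deriv_bound: "\<bar>cutoff_deriv s\<bar> \<le> 4"
proof (cases "s \<ge> 2")
  case False
  have "max 0 (1 - (max 0 (s - 1))\<^sup>2) * max 0 (s - 1) \<le> 1 * 1"
    using False by (intro mult_mono) auto
  thus ?thesis by (simp add: cutoff_deriv_def abs_mult)
qed (simp add: cutoff_outside)

section \<open>Trial functions and their pointwise bounds\<close>

text \<open>Written in \<open>s = x \<bullet> x\<close>, which is differentiable at the origin while
  the norm is not; hence the halved exponent.\<close>

definition profile :: "real \<Rightarrow> real \<Rightarrow> real \<Rightarrow> real" where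
  "profile \<gamma> \<epsilon> s = (s + \<epsilon>) powr (\<gamma> / 2) * cutoff s"

definition profile_deriv :: "real \<Rightarrow> real \<Rightarrow> real \<Rightarrow> real" where
  "profile_deriv \<gamma> \<epsilon> s =
     \<gamma> / 2 * (s + \<epsilon>) powr (\<gamma> / 2 - 1) * cutoff s + (s + \<epsilon>) powr (\<gamma> / 2) * cutoff_deriv s"

lemma DERIV_profile:
  assumes "s + \<epsilon> > 0"
  shows "(profile \<gamma> \<epsilon> has_real_derivative profile_deriv \<gamma> \<epsilon> s) (at s)"
  unfolding profile_def[abs_def] profile_deriv_def
  using assms by (auto intro!: derivative_eq_intros DERIV_cutoff simp: field_simps)

lemma continuous_on_profile_deriv:
  assumes "\<epsilon> > 0" shows "continuous_on {0..} (profile_deriv \<gamma> \<epsilon>)"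
proof -
  have "continuous_on {0..} cutoff"
    by (meson DERIV_cutoff DERIV_isCont continuous_at_imp_continuous_on)
  moreover have "continuous_on {0..} cutoff_deriv"
    unfolding cutoff_deriv_def[abs_def] by (intro continuous_intros)
  ultimately show ?thesis
    unfolding profile_deriv_def[abs_def] using assms by (auto intro!: continuous_intros)
qed

definition trial :: "real \<Rightarrow> real \<Rightarrow> real^'n \<Rightarrow> real" where
  "trial \<gamma> \<epsilon> x = profile \<gamma> \<epsilon> (x \<bullet> x)"

definition trial_grad :: "real \<Rightarrow> real \<Rightarrow> real^'n \<Rightarrow> real^'n" where
  "trial_grad \<gamma> \<epsilon> x = (2 * profile_deriv \<gamma> \<epsilon> (x \<bullet> x)) *\<^sub>R x"

lemma has_derivative_trial:
  assumes "\<epsilon> > 0"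
  shows "(trial \<gamma> \<epsilon> has_derivative (\<lambda>h. trial_grad \<gamma> \<epsilon> x \<bullet> h)) (at x)"
proof -
  have d: "((\<lambda>x. x \<bullet> x) has_derivative (\<lambda>h. 2 * (x \<bullet> h))) (at x)"
    by (auto intro!: derivative_eq_intros simp: inner_commute)
  have "x \<bullet> x + \<epsilon> > 0" using assms by (simp add: add_nonneg_pos)
  from has_derivative_compose[OF d DERIV_profile[OF this, unfolded has_field_derivative_def]]
  show ?thesis
    by (simp add: trial_def[abs_def] trial_grad_def[abs_def] mult_ac)
qed

lemma continuous_on_trial_grad: "\<epsilon> > 0 \<Longrightarrow> continuous_on UNIV (trial_grad \<gamma> \<epsilon>)"
  unfolding trial_grad_def[abs_def]
  by (intro continuous_intros continuous_on_compose2[OF continuous_on_profile_deriv]) auto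

lemma continuous_on_trial: "\<epsilon> > 0 \<Longrightarrow> continuous_on UNIV (trial \<gamma> \<epsilon>)"
  using has_derivative_trial by (meson continuous_at_imp_continuous_on has_derivative_continuous)

text \<open>The cutoff already vanishes for \<open>x \<bullet> x \<ge> 2\<close>; the radius 2 is a
  convenient enlargement of the square root of 2.\<close>

lemma trial_outside:
  assumes "norm x > 2"
  shows "trial \<gamma> \<epsilon> x = 0" "trial_grad \<gamma> \<epsilon> x = 0"
proof -
  have "2 * 2 < norm x * norm x" using assms by (intro mult_strict_mono) auto
  hence "x \<bullet> x \<ge> 2" by (simp add: power2_norm_eq_inner[symmetric] power2_eq_square)
  thus "trial \<gamma> \<epsilon> x = 0" "trial_grad \<gamma> \<epsilon> x = 0"
    by (simp_all add: trial_def trial_grad_def profile_def profile_deriv_def cutoff_outside)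
qed

text \<open>In the transition shell \<open>x \<bullet> x\<close> lies between 1 and 2, so with
  \<open>\<epsilon> \<le> 1\<close> the base \<open>x \<bullet> x + \<epsilon>\<close> lies between
  1 and 3. Powers of it are then bounded uniformly in \<epsilon>, whatever the sign of the
  exponent.\<close>

lemma powr_le_3_powr_abs:
  assumes "1 \<le> s" "s \<le> (3::real)" "\<bar>a\<bar> \<le> b"
  shows "s powr a \<le> 3 powr b"
proof -
  have "s powr a \<le> s powr b" using assms by (intro powr_mono) auto
  also have "\<dots> \<le> 3 powr b" using assms by (intro powr_mono2) auto
  finally show ?thesis .
qed

text \<open>A majorant free of \<epsilon>, for the L2 norm. The origin is excluded because for
  negative \<gamma> the value there, \<open>\<epsilon> powr \<gamma>\<close>, blows up as \<epsilon>
  tends to 0.\<close>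

lemma trial_squared_le:
  fixes x :: "real^'n"
  assumes "0 < \<epsilon>" "\<epsilon> \<le> 1" "x \<noteq> 0"
  shows "(trial \<gamma> \<epsilon> x)\<^sup>2 \<le> indicator (cball 0 1 - {0}) x * norm x powr (2 * \<gamma>) + 3 powr \<bar>\<gamma>\<bar> * indicator (cball 0 2) x"
proof -
  let ?s = "x \<bullet> x"
  have s: "?s > 0" "?s = (norm x)\<^sup>2" using assms by (auto simp: power2_norm_eq_inner)
  have "(trial \<gamma> \<epsilon> x)\<^sup>2 = (?s + \<epsilon>) powr \<gamma> * (cutoff ?s)\<^sup>2"
    using assms s by (simp add: trial_def profile_def power_mult_distrib powr_powr flip: powr_numeral)
  also have "\<dots> \<le> (?s + \<epsilon>) powr \<gamma> * 1"
    by (intro mult_left_mono power_le_one cutoff_bounds) auto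
  finally have le: "(trial \<gamma> \<epsilon> x)\<^sup>2 \<le> (?s + \<epsilon>) powr \<gamma>" by simp
  consider "norm x > 2" | "norm x \<le> 2" "?s \<ge> 2" | "norm x \<le> 2" "?s < 2" "norm x > 1" | "norm x \<le> 1" "\<gamma> < 0" | "norm x \<le> 1" "\<gamma> \<ge> 0" by linarith
  thus ?thesis
  proof cases
    case 1 thus ?thesis by (simp add: trial_outside)
  next
    case 2 thus ?thesis by (simp add: trial_def profile_def cutoff_outside)
  next
    case 3
    have "?s \<ge> 1" using 3 s by simp
    hence "(?s + \<epsilon>) powr \<gamma> \<le> 3 powr \<bar>\<gamma>\<bar>" using 3 assms by (intro powr_le_3_powr_abs) auto
    with le 3 show ?thesis by (simp add: indicator_def)
  next
    case 4
    \<comment> \<open>With a negative exponent, dropping \<epsilon> increases the power; this case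
      produces the singular term of the bound.\<close>
    have "(?s + \<epsilon>) powr \<gamma> \<le> ?s powr \<gamma>" using 4 s assms by (intro powr_mono2') auto
    also have "?s powr \<gamma> = norm x powr (2 * \<gamma>)" using assms by (simp add: s(2) powr_powr flip: powr_numeral)
    finally show ?thesis using le 4 assms by (simp add: indicator_def add_increasing2)
  next
    case 5
    have "?s \<le> 1" using 5 s(2) by (simp add: power_le_one)
    hence "(?s + \<epsilon>) powr \<gamma> \<le> 3 powr \<gamma>" using 5 s assms by (intro powr_mono2) auto
    with le 5 assms show ?thesis by (simp add: indicator_def add_increasing)
  qed
qed

text \<open>The singular term carries exactly the factor \<open>\<gamma>\<^sup>2\<close>, to be
  compared with \<open>c\<close>. The derivative of the cutoff acts only in the shell, where
  everything is bounded uniformly in \<epsilon>.\<close>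

lemma trial_grad_squared_le:
  fixes x :: "real^'n"
  assumes "0 < \<epsilon>" "\<epsilon> \<le> 1"
  shows "(norm (trial_grad \<gamma> \<epsilon> x))\<^sup>2 \<le>
    \<gamma>\<^sup>2 * (indicator (cball 0 1 - {0}) x * (x \<bullet> x + \<epsilon>) powr (\<gamma> - 1)) +
    (4 * (\<bar>\<gamma>\<bar> + 4) * 3 powr (\<bar>\<gamma>\<bar> + 1))\<^sup>2 * indicator (cball 0 2) x"
proof -
  let ?s = "x \<bullet> x"
  have s: "?s \<ge> 0" "?s = (norm x)\<^sup>2" by (auto simp: power2_norm_eq_inner)
  consider "x = 0" | "norm x > 2" | "norm x \<le> 2" "norm x > 1" "?s \<ge> 2" | "norm x \<le> 2" "?s < 2" "norm x > 1" | "norm x \<le> 1" "x \<noteq> 0" by linarith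
  thus ?thesis
  proof cases
    case 1 thus ?thesis by (simp add: trial_grad_def)
  next
    case 2 thus ?thesis by (simp add: trial_outside)
  next
    case 3 thus ?thesis by (simp add: trial_grad_def profile_deriv_def cutoff_outside)
  next
    case 4
    have s1: "?s \<ge> 1" using 4 s by simp
    have p1: "(?s + \<epsilon>) powr (\<gamma> / 2 - 1) \<le> 3 powr (\<bar>\<gamma>\<bar> + 1)"
      and p2: "(?s + \<epsilon>) powr (\<gamma> / 2) \<le> 3 powr (\<bar>\<gamma>\<bar> + 1)"
      using 4 s1 assms by (intro powr_le_3_powr_abs; linarith)+
    have "\<bar>profile_deriv \<gamma> \<epsilon> ?s\<bar> \<le> \<bar>\<gamma> / 2\<bar> * (?s + \<epsilon>) powr (\<gamma> / 2 - 1) * \<bar>cutoff ?s\<bar> + (?s + \<epsilon>) powr (\<gamma> / 2) * \<bar>cutoff_deriv ?s\<bar>"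
      unfolding profile_deriv_def by (rule order_trans[OF abs_triangle_ineq]) (simp add: abs_mult)
    also have "\<dots> \<le> \<bar>\<gamma>\<bar> * 3 powr (\<bar>\<gamma>\<bar> + 1) * 1 + 3 powr (\<bar>\<gamma>\<bar> + 1) * 4"
      using p1 p2 cutoff_bounds[of ?s] cutoff_deriv_bound[of ?s]
      by (intro add_mono mult_mono) auto
    finally have P: "\<bar>profile_deriv \<gamma> \<epsilon> ?s\<bar> \<le> (\<bar>\<gamma>\<bar> + 4) * 3 powr (\<bar>\<gamma>\<bar> + 1)" by (simp add: algebra_simps)
    \<comment> \<open>The constant 4 is the factor 2 from the gradient of
      \<open>x \<bullet> x\<close> times the bound 2 on \<open>norm x\<close>.\<close>
    have "norm (trial_grad \<gamma> \<epsilon> x) = 2 * \<bar>profile_deriv \<gamma> \<epsilon> ?s\<bar> * norm x"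
      by (simp add: trial_grad_def abs_mult)
    also have "\<dots> \<le> 2 * ((\<bar>\<gamma>\<bar> + 4) * 3 powr (\<bar>\<gamma>\<bar> + 1)) * 2"
      using P 4 by (intro mult_mono) auto
    also have "\<dots> = 4 * (\<bar>\<gamma>\<bar> + 4) * 3 powr (\<bar>\<gamma>\<bar> + 1)" by algebra
    finally have "norm (trial_grad \<gamma> \<epsilon> x) \<le> 4 * (\<bar>\<gamma>\<bar> + 4) * 3 powr (\<bar>\<gamma>\<bar> + 1)" .
    hence "(norm (trial_grad \<gamma> \<epsilon> x))\<^sup>2 \<le> (4 * (\<bar>\<gamma>\<bar> + 4) * 3 powr (\<bar>\<gamma>\<bar> + 1))\<^sup>2"
      by (intro power_mono) auto
    thus ?thesis using 4 by (simp add: indicator_def)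
  next
    case 5
    have s1: "?s \<le> 1" using 5 s(2) by (simp add: power_le_one)
    have pos: "?s + \<epsilon> > 0" using s assms by linarith
    have "(norm (trial_grad \<gamma> \<epsilon> x))\<^sup>2 = \<gamma>\<^sup>2 * (?s + \<epsilon>) powr (\<gamma> - 2) * ?s"
      using s1 pos by (simp add: trial_grad_def profile_deriv_def cutoff_eq_1 cutoff_deriv_eq_0 power_mult_distrib s(2)[symmetric] powr_powr algebra_simps flip: powr_numeral)
    \<comment> \<open>Enlarging \<open>?s\<close> to \<open>?s + \<epsilon>\<close> absorbs one
      power and produces the same integrand as the lower bound for the Hardy term.\<close>
    also have "\<dots> \<le> \<gamma>\<^sup>2 * (?s + \<epsilon>) powr (\<gamma> - 2) * (?s + \<epsilon>)"
      using assms by (intro mult_left_mono) auto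
    also have "\<dots> = \<gamma>\<^sup>2 * (?s + \<epsilon>) powr (\<gamma> - 1)"
      using pos powr_add[of "?s + \<epsilon>" "\<gamma> - 2" 1] by simp
    finally show ?thesis using 5 by (simp add: indicator_def add_increasing2)
  qed
qed

text \<open>On the unit ball the cutoff is 1, and enlarging the denominator
  \<open>x \<bullet> x\<close> to \<open>x \<bullet> x + \<epsilon>\<close> only lowers the
  quotient.\<close>

lemma trial_squared_over_norm_ge:
  fixes x :: "real^'n"
  assumes "0 < \<epsilon>"
  shows "indicator (cball 0 1 - {0}) x * (x \<bullet> x + \<epsilon>) powr (\<gamma> - 1) \<le> (trial \<gamma> \<epsilon> x)\<^sup>2 / (norm x)\<^sup>2"
proof (cases "x \<in> cball 0 1 - {0}")
  case True
  let ?s = "x \<bullet> x"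
  have s: "?s > 0" "?s = (norm x)\<^sup>2" using True by (auto simp: power2_norm_eq_inner)
  have s1: "?s \<le> 1" using True s(2) by (simp add: power_le_one)
  have pos: "?s + \<epsilon> > 0" using s assms by linarith
  have "(?s + \<epsilon>) powr (\<gamma> - 1) = (?s + \<epsilon>) powr \<gamma> / (?s + \<epsilon>)"
    using pos by (simp add: powr_diff)
  also have "\<dots> \<le> (?s + \<epsilon>) powr \<gamma> / ?s"
    using s(1) pos assms by (intro divide_left_mono mult_pos_pos) auto
  also have "(?s + \<epsilon>) powr \<gamma> = (trial \<gamma> \<epsilon> x)\<^sup>2"
    using s1 pos by (simp add: trial_def profile_def cutoff_eq_1 powr_powr flip: powr_numeral)
  finally show ?thesis using True s by simp
qed simp


section \<open>The weighted measure and its integrability exponents\<close>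

text \<open>A pointwise limit of integrable truncations to growing balls. This supplies the
  measurability of the density \<mu>, which is only assumed locally integrable.\<close>

lemma borel_measurable_locally_integrable:
  fixes f :: "real^'n \<Rightarrow> real"
  assumes "locally_integrable lebesgue f"
  shows "f \<in> borel_measurable lebesgue"
proof (rule borel_measurable_LIMSEQ_real)
  show "(\<lambda>x. indicator (cball 0 (real n)) x * f x) \<in> borel_measurable lebesgue" for n
  proof -
    have "set_integrable lebesgue (cball 0 (real n)) f"
      using assms compact_cball unfolding locally_integrable_def by blast
    thus ?thesis
      unfolding set_integrable_def real_scaleR_def by (rule borel_measurable_integrable)
  qed
  fix x :: "real^'n"
  obtain m where "norm x \<le> real m" using real_arch_simple by blast
  hence "\<forall>\<^sub>F n in sequentially. f x = indicator (cball 0 (real n)) x * f x"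
    by (intro eventually_sequentiallyI[of m]) (auto simp: indicator_def)
  thus "(\<lambda>n. indicator (cball 0 (real n)) x * f x) \<longlonglongrightarrow> f x"
    by (rule Lim_transform_eventually[OF tendsto_const])
qed

lemma sets_weighted_measure: "sets (weighted_measure \<mu>) = sets lebesgue"
  by (simp add: weighted_measure_def)

lemma borel_measurable_weighted_measure:
  assumes "f \<in> borel_measurable borel"
  shows "f \<in> borel_measurable (weighted_measure \<mu>)"
  unfolding measurable_cong_sets[OF sets_weighted_measure refl]
  by (rule measurable_completion) (simp add: assms)

lemma borel_measurable_punctured_ball:
  fixes f :: "real^'n \<Rightarrow> real"
  assumes "f \<in> borel_measurable borel"
  shows "(\<lambda>x. indicator (cball 0 1 - {0}) x * f x) \<in> borel_measurable borel"
  using assms by (intro borel_measurable_times borel_measurable_indicator) simp_all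

lemma emeasure_weighted_measure_cball:
  fixes \<mu> :: "real^'n \<Rightarrow> real"
  assumes "locally_integrable lebesgue \<mu>"
  shows "emeasure (weighted_measure \<mu>) (cball 0 R) < \<infinity>"
proof -
  have "set_integrable lebesgue (cball 0 R) \<mu>"
    using assms by (simp add: locally_integrable_def)
  hence fin: "(\<integral>\<^sup>+x. ennreal (norm (indicator (cball 0 R) x *\<^sub>R \<mu> x)) \<partial>lebesgue) < \<infinity>"
    unfolding set_integrable_def integrable_iff_bounded by (rule conjunct2)
  have "emeasure (weighted_measure \<mu>) (cball 0 R)
      = (\<integral>\<^sup>+x. ennreal (\<mu> x) * indicator (cball 0 R) x \<partial>lebesgue)"
    unfolding weighted_measure_def
    by (rule emeasure_density[OF measurable_compose[OF borel_measurable_locally_integrable[OF assms] measurable_ennreal]]) simp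
  also have "\<dots> \<le> (\<integral>\<^sup>+x. ennreal (norm (indicator (cball 0 R) x *\<^sub>R \<mu> x)) \<partial>lebesgue)"
    \<comment> \<open>\<open>ennreal\<close> truncates at 0, so the density is dominated by the
      absolute value of \<mu>.\<close>
    by (intro nn_integral_mono) (auto simp: indicator_def intro!: ennreal_leI)
  also note fin
  finally show ?thesis .
qed

text \<open>Points are Lebesgue null and the measure has a density. This allows estimates valid off
  the origin to be integrated.\<close>

lemma AE_weighted_measure_nonzero:
  fixes \<mu> :: "real^'n \<Rightarrow> real"
  assumes "locally_integrable lebesgue \<mu>"
  shows "AE x in weighted_measure \<mu>. x \<noteq> 0"
proof -
  have ae: "AE x in lebesgue. x \<noteq> (0::real^'n)"
    by (rule AE_completion[OF AE_lborel_singleton])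
  have "(\<lambda>x. ennreal (\<mu> x)) \<in> borel_measurable lebesgue"
    by (rule measurable_compose[OF borel_measurable_locally_integrable[OF assms] measurable_ennreal])
  note d = AE_density[OF this]
  have "AE x in lebesgue. 0 < ennreal (\<mu> x) \<longrightarrow> x \<noteq> 0"
    using ae by (rule eventually_mono) (rule impI)
  thus ?thesis unfolding weighted_measure_def by (rule d[THEN iffD2])
qed

text \<open>This gives \<open>N0 \<ge> 0\<close>, and through it the bound
  \<open>\<gamma> \<le> 1\<close> in the theorem.\<close>

lemma zero_in_integrability_exponents:
  fixes \<mu> :: "real^'n \<Rightarrow> real"
  assumes "locally_integrable lebesgue \<mu>"
  shows "0 \<in> integrability_exponents \<mu>"
  unfolding integrability_exponents_def locally_integrable_def mem_Collect_eq
proof (intro allI impI)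
  fix K :: "(real^'n) set" assume "compact K"
  then obtain R where R: "K \<subseteq> cball 0 R"
      using compact_imp_bounded[OF \<open>compact K\<close>] by (auto simp: bounded_iff subset_iff)
  have [measurable]: "K \<in> sets borel" using \<open>compact K\<close> by (rule borel_compact)
  show "set_integrable (weighted_measure \<mu>) K (\<lambda>x. norm x powr - 0)"
    unfolding set_integrable_def
  proof (rule integrableI_bounded_set[where A = "cball 0 R" and B = 1])
    show "cball 0 R \<in> sets (weighted_measure \<mu>)" by (simp add: sets_weighted_measure)
    show "emeasure (weighted_measure \<mu>) (cball 0 R) < \<infinity>"
      by (rule emeasure_weighted_measure_cball[OF assms])
    show "(\<lambda>x. indicat_real K x *\<^sub>R norm x powr - 0) \<in> borel_measurable (weighted_measure \<mu>)"
      by (rule borel_measurable_weighted_measure) measurable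
  qed (use R in \<open>auto simp: indicator_def intro!: AE_I2\<close>)
qed

text \<open>Non-integrability must come from the origin: for \<open>\<delta> \<ge> 0\<close> the
  power is at most 1 outside the unit ball, and balls have finite measure. A finite integral over
  the punctured unit ball would thus give local integrability.\<close>

lemma nn_integral_powr_infinite:
  fixes \<mu> :: "real^'n \<Rightarrow> real"
  assumes li: "locally_integrable lebesgue \<mu>"
    and \<delta>: "\<delta> \<notin> integrability_exponents \<mu>" "\<delta> \<ge> 0"
  shows "(\<integral>\<^sup>+x. ennreal (indicator (cball 0 1 - {0}) x * norm x powr - \<delta>) \<partial>weighted_measure \<mu>) = \<infinity>"
proof (rule ccontr)
  let ?M = "weighted_measure \<mu>" and ?f = "\<lambda>x::real^'n. indicator (cball 0 1 - {0}) x * norm x powr - \<delta>"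
  assume "\<not> ?thesis"
  hence "(\<integral>\<^sup>+x. ennreal (?f x) \<partial>?M) < \<infinity>" by (simp only: less_top infinity_ennreal_def not_False_eq_True)
  moreover have "?f \<in> borel_measurable ?M"
    by (intro borel_measurable_weighted_measure borel_measurable_punctured_ball) measurable
  ultimately have f: "integrable ?M ?f"
    by (intro integrableI_nonneg AE_I2) simp_all
  have "locally_integrable ?M (\<lambda>x. norm x powr - \<delta>)"
    unfolding locally_integrable_def
  proof (intro allI impI)
    fix K :: "(real^'n) set" assume "compact K"
    then obtain R where R: "K \<subseteq> cball 0 R"
      using compact_imp_bounded[OF \<open>compact K\<close>] by (auto simp: bounded_iff subset_iff)
    have K[measurable]: "K \<in> sets borel" using \<open>compact K\<close> by (rule borel_compact)
    have "integrable ?M (\<lambda>x. indicator (cball 0 R) x :: real)"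
      using emeasure_weighted_measure_cball[OF li, of R]
      by (intro integrable_real_indicator) (simp_all add: sets_weighted_measure)
    hence dom: "integrable ?M (\<lambda>x. ?f x + indicator (cball 0 R) x)"
      using f by (rule Bochner_Integration.integrable_add[rotated])
    have meas: "(\<lambda>x. indicat_real K x *\<^sub>R norm x powr - \<delta>) \<in> borel_measurable ?M"
      by (rule borel_measurable_weighted_measure) measurable
    have le: "norm (indicat_real K x *\<^sub>R norm x powr - \<delta>) \<le> norm (?f x + indicator (cball 0 R) x)" for x
    proof (cases "x \<in> K \<and> x \<noteq> 0")
      case True
      hence R: "x \<in> cball 0 R" using R by blast
      show ?thesis
      proof (cases "norm x \<le> 1")
        case False
        have "norm x powr - \<delta> \<le> norm x powr 0"
          by (rule powr_mono) (use \<delta>(2) False in linarith)+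
        hence "norm x powr - \<delta> \<le> 1" using True by (simp only: powr_zero_eq_one norm_eq_zero simp_thms if_False)
        thus ?thesis using True False R by (simp add: indicator_def)
      qed (use True R in \<open>simp add: indicator_def\<close>)
    next
      case False
      \<comment> \<open>At the origin the power is \<open>0 powr - \<delta>\<close>, which is 0, so
        puncturing the ball loses nothing.\<close>
      hence "indicat_real K x *\<^sub>R norm x powr - \<delta> = 0" by (auto simp: indicator_def)
      thus ?thesis by (simp only: norm_zero norm_ge_zero)
    qed
    show "set_integrable ?M K (\<lambda>x. norm x powr - \<delta>)"
      unfolding set_integrable_def
      by (rule Bochner_Integration.integrable_bound[OF dom meas AE_I2[OF le]])
  qed
  with \<delta>(1) show False by (simp add: integrability_exponents_def)
qed

text \<open>Inside the unit ball a larger exponent gives a smaller power, so integrability passes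
  from \<open>- \<delta>\<close> to every \<open>a\<close> above it.\<close>

lemma nn_integral_powr_finite:
  assumes "\<delta> \<in> integrability_exponents \<mu>" "- \<delta> \<le> a"
  shows "(\<integral>\<^sup>+x. ennreal (indicator (cball 0 1 - {0}) x * norm x powr a) \<partial>weighted_measure \<mu>) < \<infinity>"
proof -
  let ?M = "weighted_measure \<mu>"
  have "set_integrable ?M (cball 0 1) (\<lambda>x. norm x powr - \<delta>)"
    using assms by (simp add: integrability_exponents_def locally_integrable_def)
  hence fin: "(\<integral>\<^sup>+x. ennreal (norm (indicator (cball 0 1) x *\<^sub>R norm x powr - \<delta>)) \<partial>?M) < \<infinity>"
    unfolding set_integrable_def integrable_iff_bounded by (rule conjunct2)
  have "(\<integral>\<^sup>+x. ennreal (indicator (cball 0 1 - {0}) x * norm x powr a) \<partial>?M)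
      \<le> (\<integral>\<^sup>+x. ennreal (norm (indicator (cball 0 1) x *\<^sub>R norm x powr - \<delta>)) \<partial>?M)"
    using assms(2) by (intro nn_integral_mono) (auto simp: indicator_def intro!: ennreal_leI powr_mono')
  also note fin
  finally show ?thesis .
qed

section \<open>Trial functions in the Hardy inequality\<close>

text \<open>Function and gradient are continuous and vanish outside a ball of finite weighted
  measure. The gradient is named explicitly since the Hardy inequality takes it as an
  argument.\<close>

lemma trial_in_H1_weighted:
  assumes li: "locally_integrable lebesgue \<mu>" and "\<epsilon> > 0"
  shows "trial \<gamma> \<epsilon> \<in> H1_weighted \<mu>" "has_weak_gradient (trial \<gamma> \<epsilon>) (trial_grad \<gamma> \<epsilon>)"
proof -
  have L2: "f \<in> L2_weighted \<mu>" if "continuous_on UNIV f" "\<And>x. norm x > 2 \<Longrightarrow> f x = 0" for f :: "real^'a \<Rightarrow> real"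
    unfolding L2_weighted_def mem_Collect_eq
  proof
    show "f \<in> borel_measurable (weighted_measure \<mu>)"
      by (intro borel_measurable_weighted_measure borel_measurable_continuous_onI that)
    have "continuous_on UNIV (\<lambda>x. (f x)\<^sup>2)" using that(1) by (intro continuous_intros)
    thus "integrable (weighted_measure \<mu>) (\<lambda>x. (f x)\<^sup>2)"
      by (intro integrable_continuous_compact_support[where R = 2] emeasure_weighted_measure_cball[OF li]
          borel_measurable_weighted_measure borel_measurable_continuous_onI)
        (simp_all add: that(2) sets_weighted_measure)
  qed
  show g: "has_weak_gradient (trial \<gamma> \<epsilon>) (trial_grad \<gamma> \<epsilon>)"
    by (rule has_weak_gradient_continuously_differentiable[OF has_derivative_trial continuous_on_trial_grad trial_outside(1)])
      (use assms(2) in simp_all)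
  have "trial \<gamma> \<epsilon> \<in> L2_weighted \<mu>"
    using assms(2) by (intro L2 continuous_on_trial) (simp_all add: trial_outside)
  moreover have "(\<lambda>x. trial_grad \<gamma> \<epsilon> x $ i) \<in> L2_weighted \<mu>" for i
    using assms(2) by (intro L2 continuous_on_component continuous_on_trial_grad) (simp_all add: trial_outside)
  ultimately show "trial \<gamma> \<epsilon> \<in> H1_weighted \<mu>"
    using g by (auto simp: H1_weighted_def)
qed

text \<open>The point is that \<open>K\<close> does not depend on \<epsilon>. The exponent \<delta>
  controls the L2 norm, and \<open>\<gamma>\<^sup>2 < c\<close> lets the singular part of the
  Dirichlet integral be absorbed on the left.\<close>

lemma hardy_trial_bound:
  fixes \<mu> :: "real^'n \<Rightarrow> real"
  assumes li: "locally_integrable lebesgue \<mu>"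
    and \<delta>: "\<delta> \<in> integrability_exponents \<mu>" "- \<delta> \<le> 2 * \<gamma>"
    and \<gamma>: "\<gamma> \<le> 1" "\<gamma>\<^sup>2 < c"
  shows "\<exists>K. \<forall>\<epsilon>. 0 < \<epsilon> \<longrightarrow> \<epsilon> \<le> 1 \<longrightarrow> weighted_Hardy_inequality \<mu> c C (trial \<gamma> \<epsilon>) (trial_grad \<gamma> \<epsilon>) \<longrightarrow>
      (\<integral>\<^sup>+x. ennreal (indicator (cball 0 1 - {0}) x * (x \<bullet> x + \<epsilon>) powr (\<gamma> - 1)) \<partial>weighted_measure \<mu>) \<le> ennreal K"
proof -
  let ?M = "weighted_measure \<mu>"
  define A :: "(real^'n) set" where "A = cball 0 1 - {0}"
  define G where "G = (4 * (\<bar>\<gamma>\<bar> + 4) * 3 powr (\<bar>\<gamma>\<bar> + 1))\<^sup>2"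
  have ennreal_M: "(\<lambda>x. ennreal (f x)) \<in> borel_measurable ?M"
    if "f \<in> borel_measurable borel" for f :: "real^'n \<Rightarrow> real"
    by (rule measurable_compose[OF borel_measurable_weighted_measure[OF that] measurable_ennreal])
  have ind: "(\<lambda>x::real^'n. b * indicator (cball 0 R) x) \<in> borel_measurable borel" for b R :: real
    by (intro borel_measurable_times borel_measurable_indicator) simp_all
  have A: "(\<lambda>x. indicator A x * f x) \<in> borel_measurable borel"
    if "f \<in> borel_measurable borel" for f :: "real^'n \<Rightarrow> real"
    unfolding A_def by (rule borel_measurable_punctured_ball[OF that])
  have ball: "emeasure ?M (cball 0 R) < top" for R
    using emeasure_weighted_measure_cball[OF li, of R] by simp
  have ball': "(\<integral>\<^sup>+x. ennreal (b * indicator (cball 0 R) x) \<partial>?M) < top" for b R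
  proof -
    have "(\<integral>\<^sup>+x. ennreal (b * indicator (cball 0 R) x) \<partial>?M) = (\<integral>\<^sup>+x. ennreal b * indicator (cball 0 R) x \<partial>?M)"
      by (intro nn_integral_cong) (simp add: indicator_def)
    also have "\<dots> = ennreal b * emeasure ?M (cball 0 R)"
      by (rule nn_integral_cmult_indicator) (simp add: sets_weighted_measure)
    also have "\<dots> < top" using ball[of R] by (simp add: ennreal_mult_less_top)
    finally show ?thesis .
  qed
  \<comment> \<open>\<open>K1\<close> bounds the shell part of the Dirichlet integral and
    \<open>K2\<close> the squared L2 norm, both for all \<epsilon> in question. Their finiteness
    matters because \<open>enn2real\<close> sends infinity to 0.\<close>
  define K1 where "K1 = enn2real (\<integral>\<^sup>+x. ennreal (G * indicator (cball 0 2) x) \<partial>?M)"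
  have K1: "(\<integral>\<^sup>+x. ennreal (G * indicator (cball 0 2) x) \<partial>?M) = ennreal K1" "K1 \<ge> 0"
    using ball'[of G 2] by (simp_all add: K1_def)
  define K2 where "K2 = enn2real (\<integral>\<^sup>+x. ennreal (indicator A x * norm x powr (2 * \<gamma>) + 3 powr \<bar>\<gamma>\<bar> * indicator (cball 0 2) x) \<partial>?M)"
  have K2: "(\<integral>\<^sup>+x. ennreal (indicator A x * norm x powr (2 * \<gamma>) + 3 powr \<bar>\<gamma>\<bar> * indicator (cball 0 2) x) \<partial>?M) = ennreal K2" "K2 \<ge> 0"
  proof -
    have "(\<integral>\<^sup>+x. ennreal (indicator A x * norm x powr (2 * \<gamma>) + 3 powr \<bar>\<gamma>\<bar> * indicator (cball 0 2) x) \<partial>?M)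
      = (\<integral>\<^sup>+x. ennreal (indicator A x * norm x powr (2 * \<gamma>)) + ennreal (3 powr \<bar>\<gamma>\<bar> * indicator (cball 0 2) x) \<partial>?M)"
      by (intro nn_integral_cong ennreal_plus) simp_all
    also have "\<dots> = (\<integral>\<^sup>+x. ennreal (indicator A x * norm x powr (2 * \<gamma>)) \<partial>?M)
        + (\<integral>\<^sup>+x. ennreal (3 powr \<bar>\<gamma>\<bar> * indicator (cball 0 2) x) \<partial>?M)"
      by (intro nn_integral_add ennreal_M A ind) measurable
    also have "\<dots> < top"
      using nn_integral_powr_finite[OF \<delta>] ball'[of "3 powr \<bar>\<gamma>\<bar>" 2]
      unfolding A_def by (simp only: ennreal_add_less_top infinity_ennreal_def)
    finally show "(\<integral>\<^sup>+x. ennreal (indicator A x * norm x powr (2 * \<gamma>) + 3 powr \<bar>\<gamma>\<bar> * indicator (cball 0 2) x) \<partial>?M) = ennreal K2"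
      unfolding K2_def by (rule ennreal_enn2real[symmetric])
  qed (simp add: K2_def)
  show ?thesis
  proof (intro exI allI impI)
    fix \<epsilon> :: real assume \<epsilon>: "0 < \<epsilon>" "\<epsilon> \<le> 1"
    let ?f = "\<lambda>x. indicator A x * (x \<bullet> x + \<epsilon>) powr (\<gamma> - 1)"
    let ?I = "\<integral>\<^sup>+x. ennreal (?f x) \<partial>?M"
    let ?P = "\<integral>\<^sup>+x. ennreal ((trial \<gamma> \<epsilon> x)\<^sup>2 / (norm x)\<^sup>2) \<partial>?M"
    let ?Q = "\<integral>\<^sup>+x. ennreal ((norm (trial_grad \<gamma> \<epsilon> x))\<^sup>2) \<partial>?M"
    let ?L = "\<integral>\<^sup>+x. ennreal ((trial \<gamma> \<epsilon> x)\<^sup>2) \<partial>?M"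
    have f: "?f \<in> borel_measurable borel" by (intro A) measurable
    assume H: "weighted_Hardy_inequality \<mu> c C (trial \<gamma> \<epsilon>) (trial_grad \<gamma> \<epsilon>)"
    \<comment> \<open>This bound depends on \<epsilon> and uses \<open>\<gamma> \<le> 1\<close>. It
      serves only to make \<open>?I\<close> a real number, so that a multiple of it can be
      subtracted later.\<close>
    have "?I \<le> (\<integral>\<^sup>+x. ennreal (\<epsilon> powr (\<gamma> - 1) * indicator (cball 0 1) x) \<partial>?M)"
      using \<epsilon> \<gamma> by (intro nn_integral_mono)
        (auto simp: indicator_def A_def intro!: ennreal_leI powr_mono2')
    also have "\<dots> < top" by (rule ball')
    finally obtain i where i: "?I = ennreal i" "i \<ge> 0"
      by (cases ?I) auto
    have P: "ennreal i \<le> ?P"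
      unfolding i(1)[symmetric] A_def
      by (intro nn_integral_mono ennreal_leI trial_squared_over_norm_ge \<epsilon>)
    have "(\<integral>\<^sup>+x. ennreal (\<gamma>\<^sup>2 * ?f x) \<partial>?M) = (\<integral>\<^sup>+x. ennreal (\<gamma>\<^sup>2) * ennreal (?f x) \<partial>?M)"
      by (intro nn_integral_cong ennreal_mult) simp_all
    also have "\<dots> = ennreal (\<gamma>\<^sup>2) * ?I"
      by (rule nn_integral_cmult[OF ennreal_M[OF f]])
    finally have sq_I: "(\<integral>\<^sup>+x. ennreal (\<gamma>\<^sup>2 * ?f x) \<partial>?M) = ennreal (\<gamma>\<^sup>2) * ?I" .
    have "?Q \<le> (\<integral>\<^sup>+x. ennreal (\<gamma>\<^sup>2 * ?f x + G * indicator (cball 0 2) x) \<partial>?M)"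
      unfolding A_def G_def by (intro nn_integral_mono ennreal_leI trial_grad_squared_le \<epsilon>)
    also have "\<dots> = (\<integral>\<^sup>+x. ennreal (\<gamma>\<^sup>2 * ?f x) + ennreal (G * indicator (cball 0 2) x) \<partial>?M)"
      by (intro nn_integral_cong ennreal_plus) (simp_all add: G_def)
    also have "\<dots> = (\<integral>\<^sup>+x. ennreal (\<gamma>\<^sup>2 * ?f x) \<partial>?M) + (\<integral>\<^sup>+x. ennreal (G * indicator (cball 0 2) x) \<partial>?M)"
      by (rule nn_integral_add[OF ennreal_M[OF borel_measurable_times[OF borel_measurable_const f]] ennreal_M[OF ind]])
    also have "\<dots> = ennreal (\<gamma>\<^sup>2) * ?I + ennreal K1"
      unfolding K1(1) sq_I ..
    also have "\<dots> = ennreal (\<gamma>\<^sup>2 * i + K1)"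
      unfolding i(1) using i(2) K1(2) by (simp add: ennreal_mult ennreal_plus)
    finally have Q: "?Q \<le> ennreal (\<gamma>\<^sup>2 * i + K1)" .
    then obtain q where q: "?Q = ennreal q" "q \<ge> 0" by (cases ?Q) (auto simp: top_unique)
    have "0 \<le> \<gamma>\<^sup>2 * i + K1" using i(2) K1(2) by (intro add_nonneg_nonneg mult_nonneg_nonneg) simp_all
    hence q_le: "q \<le> \<gamma>\<^sup>2 * i + K1" using Q unfolding q(1) by (simp only: ennreal_le_iff)
    have "?L \<le> ennreal K2"
      unfolding K2(1)[symmetric]
    proof (rule nn_integral_mono_AE, rule AE_mp[OF AE_weighted_measure_nonzero[OF li] AE_I2], rule impI)
      fix x :: "real^'n" assume "x \<noteq> 0"
      thus "ennreal ((trial \<gamma> \<epsilon> x)\<^sup>2)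
          \<le> ennreal (indicator A x * norm x powr (2 * \<gamma>) + 3 powr \<bar>\<gamma>\<bar> * indicator (cball 0 2) x)"
        unfolding A_def by (intro ennreal_leI trial_squared_le \<epsilon>)
    qed
    then obtain l where l: "?L = ennreal l" "l \<ge> 0" by (cases ?L) (auto simp: top_unique)
    have l_le: "l \<le> K2" using \<open>?L \<le> ennreal K2\<close> K2(2) unfolding l(1) by (simp only: ennreal_le_iff)
    have "c > 0" using \<gamma>(2) zero_le_power2[of \<gamma>] by linarith
    \<comment> \<open>\<open>?P\<close> is not known to be finite; as \<open>c > 0\<close> it can be
      replaced by its lower bound \<open>i\<close>, and the inequality becomes one between
      reals.\<close>
    have "ereal i \<le> enn2ereal ?P"
      using P i(2) by (simp only: less_eq_ennreal.rep_eq enn2ereal_ennreal)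
    hence "ereal c * ereal i \<le> ereal c * enn2ereal ?P"
      by (rule ereal_mult_left_mono) (use \<open>c > 0\<close> in simp)
    also have "\<dots> \<le> ereal q + ereal C * ereal l"
      using H unfolding weighted_Hardy_inequality_def l(1) q(1)
      by (simp only: enn2ereal_ennreal[OF l(2)] enn2ereal_ennreal[OF q(2)])
    finally have "c * i \<le> q + C * l" by (simp only: times_ereal.simps plus_ereal.simps ereal_less_eq)
    \<comment> \<open>Passing to \<open>\<bar>C\<bar>\<close> covers negative \<open>C\<close> as
      well.\<close>
    also have "C * l \<le> \<bar>C\<bar> * K2" using l(2) l_le by (intro mult_mono) simp_all
    finally have "(c - \<gamma>\<^sup>2) * i \<le> K1 + \<bar>C\<bar> * K2" using q_le by (simp add: algebra_simps)
    hence "i \<le> (K1 + \<bar>C\<bar> * K2) / (c - \<gamma>\<^sup>2)"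
      using \<gamma>(2) by (simp add: pos_le_divide_eq mult.commute)
    thus "(\<integral>\<^sup>+x. ennreal (indicator (cball 0 1 - {0}) x * (x \<bullet> x + \<epsilon>) powr (\<gamma> - 1)) \<partial>?M)
        \<le> ennreal ((K1 + \<bar>C\<bar> * K2) / (c - \<gamma>\<^sup>2))"
      unfolding A_def[symmetric] i(1) by (rule ennreal_leI)
  qed
qed

section \<open>Choice of the exponent and passage to the limit\<close>

theorem theorem4p1:
  fixes \<mu> :: "real^'n \<Rightarrow> real" and N0 c :: real
  assumes "AE x in lebesgue. 0 \<le> \<mu> x"
    and "locally_integrable lebesgue \<mu>"
    and "integrability_exponents \<mu> \<noteq> {}"
    and "bdd_above (integrability_exponents \<mu>)"
    and "N0 = Sup (integrability_exponents \<mu>)"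
    and "c > ((N0 - 2) / 2)\<^sup>2"
  shows "\<forall>C::real. \<exists>\<phi>\<in>H1_weighted \<mu>. \<exists>g. has_weak_gradient \<phi> g \<and>
           \<not> weighted_Hardy_inequality \<mu> c C \<phi> g"
proof (rule allI, rule ccontr)
  fix C :: real
  assume "\<not> (\<exists>\<phi>\<in>H1_weighted \<mu>. \<exists>g. has_weak_gradient \<phi> g \<and> \<not> weighted_Hardy_inequality \<mu> c C \<phi> g)"
  hence hardy: "weighted_Hardy_inequality \<mu> c C (trial \<gamma> \<epsilon>) (trial_grad \<gamma> \<epsilon>)" if "\<epsilon> > 0" for \<gamma> \<epsilon>
    using trial_in_H1_weighted[OF assms(2) that] by blast
  have N0: "N0 \<ge> 0"
    unfolding assms(5) by (rule cSup_upper[OF zero_in_integrability_exponents assms(4)]) fact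
  define a where "a = \<bar>(N0 - 2) / 2\<bar>"
  have "a < sqrt c"
    by (rule real_less_rsqrt) (use assms(6) in \<open>simp only: a_def power2_abs\<close>)
  \<comment> \<open>Half the gap between \<open>a\<close> and \<open>sqrt c\<close> keeps
    \<open>\<bar>\<gamma>\<bar>\<close> below \<open>sqrt c\<close>. Positivity of \<eta> gives
    \<open>2 - 2 * \<gamma> > N0\<close>, and \<open>\<eta> < 1\<close> gives
    \<open>- (2 * \<gamma>) < N0\<close>.\<close>
  define \<eta> where "\<eta> = min (1 / 2) ((sqrt c - a) / 2)"
  have \<eta>: "0 < \<eta>" "\<eta> < 1" "a + \<eta> < sqrt c"
    using \<open>a < sqrt c\<close> by (simp_all add: \<eta>_def min_def field_simps)
  define \<gamma> where "\<gamma> = 1 - N0 / 2 - \<eta>"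
  have "\<gamma> = - ((N0 - 2) / 2) - \<eta>" by (simp add: \<gamma>_def field_simps)
  hence "\<bar>\<gamma>\<bar> \<le> a + \<eta>"
    using \<eta>(1) abs_triangle_ineq4[of "- ((N0 - 2) / 2)" \<eta>] by (simp add: a_def)
  hence "\<bar>\<gamma>\<bar> < sqrt c" using \<eta>(3) by simp
  hence "\<bar>\<gamma>\<bar>\<^sup>2 < (sqrt c)\<^sup>2" by (intro power_strict_mono) simp_all
  moreover have "c > 0" using assms(6) zero_le_power2[of "(N0 - 2) / 2"] by linarith
  ultimately have \<gamma>c: "\<gamma>\<^sup>2 < c" by simp
  have \<gamma>1: "\<gamma> \<le> 1" using N0 \<eta> by (simp add: \<gamma>_def)
  have "- (2 * \<gamma>) < N0" using \<eta> by (simp add: \<gamma>_def)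
  \<comment> \<open>Being below the supremum, \<open>- (2 * \<gamma>)\<close> is exceeded by some
    admissible exponent; this keeps the L2 norms bounded.\<close>
  then obtain \<delta> where \<delta>: "\<delta> \<in> integrability_exponents \<mu>" "- (2 * \<gamma>) < \<delta>"
    unfolding assms(5) using less_cSup_iff[OF assms(3,4)] by blast
  have "2 - 2 * \<gamma> > N0" using \<eta> by (simp add: \<gamma>_def)
  hence notin: "2 - 2 * \<gamma> \<notin> integrability_exponents \<mu>"
    unfolding assms(5) using cSup_upper[OF _ assms(4)] by force
  have inf: "(\<integral>\<^sup>+x. ennreal (indicator (cball 0 1 - {0}) x * norm x powr - (2 - 2 * \<gamma>)) \<partial>weighted_measure \<mu>) = \<infinity>"
    by (rule nn_integral_powr_infinite[OF assms(2) notin]) (use \<gamma>1 in simp)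
  have "- \<delta> \<le> 2 * \<gamma>" using \<delta>(2) by simp
  have "\<exists>K. \<forall>\<epsilon>. 0 < \<epsilon> \<longrightarrow> \<epsilon> \<le> 1 \<longrightarrow> weighted_Hardy_inequality \<mu> c C (trial \<gamma> \<epsilon>) (trial_grad \<gamma> \<epsilon>) \<longrightarrow>
      (\<integral>\<^sup>+x. ennreal (indicator (cball 0 1 - {0}) x * (x \<bullet> x + \<epsilon>) powr (\<gamma> - 1)) \<partial>weighted_measure \<mu>) \<le> ennreal K"
    by (rule hardy_trial_bound) fact+
  then obtain K where
    K: "(\<integral>\<^sup>+x. ennreal (indicator (cball 0 1 - {0}) x * (x \<bullet> x + \<epsilon>) powr (\<gamma> - 1)) \<partial>weighted_measure \<mu>) \<le> ennreal K"
    if "0 < \<epsilon>" "\<epsilon> \<le> 1" for \<epsilon>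
    using hardy by blast
  define \<epsilon> where "\<epsilon> n = inverse (real (Suc n))" for n
  have \<epsilon>: "0 < \<epsilon> n" "\<epsilon> n \<le> 1" for n by (auto simp: \<epsilon>_def field_simps)
  have \<epsilon>0: "\<epsilon> \<longlonglongrightarrow> 0" unfolding \<epsilon>_def by (rule LIMSEQ_inverse_real_of_nat)
  let ?f = "\<lambda>n x. ennreal (indicator (cball 0 1 - {0}) x * (x \<bullet> x + \<epsilon> n) powr (\<gamma> - 1))"
  have lim: "(\<lambda>n. ?f n x) \<longlonglongrightarrow> ennreal (indicator (cball 0 1 - {0}) x * norm x powr - (2 - 2 * \<gamma>))" for x :: "real^'n"
  proof (cases "x = 0")
    case False
    \<comment> \<open>The limiting exponent \<open>2 * (\<gamma> - 1)\<close> is the negative of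
      \<open>2 - 2 * \<gamma>\<close>, which lies above \<open>N0\<close>.\<close>
    have "(x \<bullet> x) powr (\<gamma> - 1) = norm x powr (2 * (\<gamma> - 1))"
      using False by (simp add: power2_norm_eq_inner[symmetric] powr_powr flip: powr_numeral)
    moreover have "(\<lambda>n. (x \<bullet> x + \<epsilon> n) powr (\<gamma> - 1)) \<longlonglongrightarrow> (x \<bullet> x + 0) powr (\<gamma> - 1)"
      using False by (intro tendsto_intros \<epsilon>0) auto
    ultimately have "(\<lambda>n. (x \<bullet> x + \<epsilon> n) powr (\<gamma> - 1)) \<longlonglongrightarrow> norm x powr - (2 - 2 * \<gamma>)"
      by (simp add: algebra_simps)
    thus ?thesis by (intro tendsto_ennrealI tendsto_mult tendsto_const)
  qed simp
  \<comment> \<open>Fatou's lemma carries the bound \<open>K\<close> over to the limit integrand,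
    whose integral is infinite.\<close>
  have "(\<integral>\<^sup>+x. ennreal (indicator (cball 0 1 - {0}) x * norm x powr - (2 - 2 * \<gamma>)) \<partial>weighted_measure \<mu>)
      = (\<integral>\<^sup>+x. liminf (\<lambda>n. ?f n x) \<partial>weighted_measure \<mu>)"
    using lim_imp_Liminf[OF sequentially_bot lim] by simp
  also have "\<dots> \<le> liminf (\<lambda>n. \<integral>\<^sup>+x. ?f n x \<partial>weighted_measure \<mu>)"
    by (intro nn_integral_liminf measurable_compose[OF _ measurable_ennreal]
        borel_measurable_weighted_measure borel_measurable_punctured_ball) measurable
  also have "\<dots> \<le> liminf (\<lambda>n. ennreal K)"
    by (intro Liminf_mono always_eventually allI K \<epsilon>)
  also have "\<dots> < \<infinity>" by (simp add: Liminf_const)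
  finally show False using inf by simp
qed

end
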